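(* Let $p \geq 2$ and let $\mathbf{A}$ be a spectrally unitary $\mathbb{Z}^p$-action on $\mathbb{Z}^3$ satisfying $\mathrm{Fix}(\mathbf{A}) = \{0\}$. Then there exist a basis $\{w_1, \dots, w_p\}$ of $\mathbb{Z}^p$ and an automorphism $h$ of $\mathbb{Z}^3$ such that, for the conjugated action $\ell \mapsto h \circ \mathbf{A}(\ell) \circ h^{-1}$, written as matrices $A(\ell)$ in the canonical basis of $\mathbb{Z}^3$, $$A(w_1) = \begin{bmatrix} 1 & a & b \\ 0 & -1 & 0 \\ 0 & 0 & -1 \end{bmatrix}, \quad A(w_2) = \begin{bmatrix} -1 & 0 & c \\ 0 & -1 & d \\ 0 & 0 & 1 \end{bmatrix}$$ for some integers $a,b,c,d$ with $ad + 2(b+c) = 0$, and $A(\ell)$ is the identity matrix for every $\ell = \sum_{i=1}^p \ell_i w_i \in \mathbb{Z}^p$ with $\ell_1 = \ell_2 = 0$. In particular, the image of $\mathbf{A}$ is isomorphic to the Klein four-group.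
   Context: A $\mathbb{Z}^p$-action $\mathbf{A}$ on $\mathbb{Z}^q$ is spectrally unitary if it is a homomorphism from $\mathbb{Z}^p$ to the group of automorphisms of $\mathbb{Z}^q$ (equivalently $\mathrm{GL}(q,\mathbb{Z})$) and $1$ is an eigenvalue of $\mathbf{A}(\ell)$ for every $\ell \in \mathbb{Z}^p$. $\mathrm{Fix}(\mathbf{A}) = \{k \in \mathbb{Z}^q : \mathbf{A}(\ell)k = k \text{ for all } \ell \in \mathbb{Z}^p\}$. The image of $\mathbf{A}$ is the group $\{\mathbf{A}(\ell) : \ell \in \mathbb{Z}^p\}$. *)

theory Defs
  imports "HOL-Analysis.Analysis" "HOL-Algebra.Elementary_Groups"
begin

text \<open>Integer matrices invertible over the integers, i.e. GL(q,Z) = Aut(Z^q).\<close>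
definition int_invertible :: "int^'q^'q \<Rightarrow> bool" where
  "int_invertible M \<longleftrightarrow> (\<exists>N. M ** N = mat 1 \<and> N ** M = mat 1)"

text \<open>A Z^p-action on Z^q: a group homomorphism from Z^p to GL(q,Z).\<close>
definition Zaction :: "(int^'p \<Rightarrow> int^'q^'q) \<Rightarrow> bool" where
  "Zaction A \<longleftrightarrow> (\<forall>l. int_invertible (A l)) \<and> (\<forall>l m. A (l + m) = A l ** A m)"

text \<open>1 is an eigenvalue of an integer matrix (over the complex numbers).\<close>
definition has_eigenvalue_one :: "int^'q^'q \<Rightarrow> bool" where
  "has_eigenvalue_one M \<longleftrightarrow>
     (\<exists>v :: complex^'q. v \<noteq> 0 \<and> ((\<chi> i j. of_int (M $ i $ j)) :: complex^'q^'q) *v v = v)"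

definition spectrally_unitary :: "(int^'p \<Rightarrow> int^'q^'q) \<Rightarrow> bool" where
  "spectrally_unitary A \<longleftrightarrow> Zaction A \<and> (\<forall>l. has_eigenvalue_one (A l))"

definition Fix :: "(int^'p \<Rightarrow> int^'q^'q) \<Rightarrow> (int^'q) set" where
  "Fix A = {k. \<forall>l. A l *v k = k}"

text \<open>A family w indexed by the coordinates is a basis of the free Z-module Z^p.\<close>
definition Zbasis :: "('p \<Rightarrow> int^'p) \<Rightarrow> bool" where
  "Zbasis w \<longleftrightarrow> bij (\<lambda>c :: int^'p. \<Sum>i\<in>UNIV. c $ i *s w i)"

text \<open>The image of the action as a (multiplicative) group of matrices.\<close>
definition image_group :: "(int^'p \<Rightarrow> int^'q^'q) \<Rightarrow> (int^'q^'q) monoid" where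
  "image_group A = \<lparr>carrier = range A, mult = (**), one = mat 1\<rparr>"

definition Klein_four :: "(int \<times> int) monoid" where
  "Klein_four = integer_mod_group 2 \<times>\<times> integer_mod_group 2"

end

theory Submission
  imports Defs
begin

text \<open>
  The image $S$ of the action is a commutative group of integer $3 \times 3$ matrices, each having
  eigenvalue $1$, with no common nonzero fixed vector. Commuting matrices share an eigenline: for
  $s \neq 1$ in $S$, the image (if $s - 1$ has rank one) or the kernel (if it has rank two) of $s - 1$
  is a line invariant under $S$. A primitive generator of that line extends to a basis of
  $\mathbb{Z}^3$, in which $S$ becomes block upper triangular; the same argument on the lower
  $2 \times 2$ blocks makes $S$ upper triangular. The diagonal of an element is then a sign vector
  with at least one entry $1$. Since $S$ has no common fixed vector, every diagonal position takes
  the value $-1$ somewhere, and closure under products forces the sign vectors to be exactly the four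
  even ones. Commuting with the elements of diagonal $(1,-1,-1)$ and $(-1,-1,1)$ kills every
  unipotent element of $S$, so $S$ is a Klein four-group in the stated normal form, and the relation
  $ad + 2(b + c) = 0$ is the commutation of its two generators. Finally, transvections of
  $\mathbb{Z}^p$ move two basis vectors onto preimages of the generators and make the action of the
  remaining basis vectors trivial.
\<close>

section \<open>Matrix preliminaries\<close>

lemma matrix_mult_diff_left: "(A::'a::ring_1^'n^'m) ** (B - C) = A ** B - A ** C"
  by (simp add: matrix_matrix_mult_def vec_eq_iff algebra_simps sum_subtractf)

lemma matrix_mult_diff_right: "((B::'a::ring_1^'n^'m) - C) ** A = B ** A - C ** A"
  by (simp add: matrix_matrix_mult_def vec_eq_iff algebra_simps sum_subtractf)

lemma matrix_vector_mult_scale: "(M::'a::comm_semiring_1^'n^'m) *v (k *s x) = k *s (M *v x)"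
  by (simp add: vec_eq_iff matrix_vector_mult_def sum_distrib_left algebra_simps)

lemma conj_mult:
  fixes H Hinv :: "'a::comm_ring_1^'n^'n"
  assumes "Hinv ** H = mat 1"
  shows "(H ** h ** Hinv) ** (H ** k ** Hinv) = H ** (h ** k) ** Hinv"
proof -
  have "(H ** h ** Hinv) ** (H ** k ** Hinv) = H ** h ** (Hinv ** H) ** k ** Hinv"
    by (simp add: matrix_mul_assoc)
  then show ?thesis using assms by (simp add: matrix_mul_assoc)
qed

lemma conj_cancel:
  fixes H Hinv M :: "'a::comm_ring_1^'n^'n"
  assumes "H ** Hinv = mat 1"
  shows "H ** (Hinv ** M ** H) ** Hinv = M"
proof -
  have "H ** (Hinv ** M ** H) ** Hinv = (H ** Hinv) ** M ** (H ** Hinv)"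
    by (simp add: matrix_mul_assoc)
  with assms show ?thesis by simp
qed

lemma conj_conj_image:
  "(\<lambda>h. H2 ** h ** Hinv2) ` (\<lambda>h. H1 ** h ** Hinv1) ` S =
     (\<lambda>h. (H2 ** H1) ** h ** (Hinv1 ** Hinv2)) ` (S :: ('a::comm_ring_1^'n^'n) set)"
  by (simp add: image_image matrix_mul_assoc)

lemma conj_iso:
  fixes H Hinv :: "'a::comm_ring_1^'n^'n"
  assumes "Hinv ** H = mat 1"
  shows "\<lparr>carrier = R, mult = (**), one = mat 1\<rparr> \<cong>
    \<lparr>carrier = (\<lambda>h. H ** h ** Hinv) ` R, mult = (**), one = mat 1\<rparr>"
proof (rule is_isoI, rule isoI)
  let ?c = "\<lambda>h. H ** h ** Hinv"
  show "?c \<in> hom \<lparr>carrier = R, mult = (**), one = mat 1\<rparr>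
      \<lparr>carrier = ?c ` R, mult = (**), one = mat 1\<rparr>"
    using conj_mult[OF assms] by (auto simp: hom_def)
  have "inj ?c"
  proof (rule injI)
    fix x y
    assume "?c x = ?c y"
    then have "Hinv ** ?c x ** H = Hinv ** ?c y ** H" by simp
    then show "x = y" by (simp only: conj_cancel[OF assms])
  qed
  then show "bij_betw ?c (carrier \<lparr>carrier = R, mult = (**), one = mat 1\<rparr>)
      (carrier \<lparr>carrier = ?c ` R, mult = (**), one = mat 1\<rparr>)"
    by (simp add: bij_betw_def inj_def inj_on_def)
qed

section \<open>Explicit $3 \times 3$ matrices\<close>

definition mat3 :: "'a::zero \<Rightarrow> 'a \<Rightarrow> 'a \<Rightarrow> 'a \<Rightarrow> 'a \<Rightarrow> 'a \<Rightarrow> 'a \<Rightarrow> 'a \<Rightarrow> 'a \<Rightarrow> 'a^3^3" where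
  "mat3 a11 a12 a13 a21 a22 a23 a31 a32 a33 =
     vector [vector [a11, a12, a13], vector [a21, a22, a23], vector [a31, a32, a33]]"

definition vec3 :: "'a::zero \<Rightarrow> 'a \<Rightarrow> 'a \<Rightarrow> 'a^3" where
  "vec3 a b c = vector [a, b, c]"

lemma mat3_nth [simp]:
  "mat3 a11 a12 a13 a21 a22 a23 a31 a32 a33 $ 1 $ 1 = a11"
  "mat3 a11 a12 a13 a21 a22 a23 a31 a32 a33 $ 1 $ 2 = a12"
  "mat3 a11 a12 a13 a21 a22 a23 a31 a32 a33 $ 1 $ 3 = a13"
  "mat3 a11 a12 a13 a21 a22 a23 a31 a32 a33 $ 2 $ 1 = a21"
  "mat3 a11 a12 a13 a21 a22 a23 a31 a32 a33 $ 2 $ 2 = a22"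
  "mat3 a11 a12 a13 a21 a22 a23 a31 a32 a33 $ 2 $ 3 = a23"
  "mat3 a11 a12 a13 a21 a22 a23 a31 a32 a33 $ 3 $ 1 = a31"
  "mat3 a11 a12 a13 a21 a22 a23 a31 a32 a33 $ 3 $ 2 = a32"
  "mat3 a11 a12 a13 a21 a22 a23 a31 a32 a33 $ 3 $ 3 = a33"
  by (simp_all add: mat3_def)

lemma vec3_nth [simp]: "vec3 a b c $ 1 = a" "vec3 a b c $ 2 = b" "vec3 a b c $ 3 = c"
  by (simp_all add: vec3_def)

lemma mat3_eq_iff_entries:
  "(M::'a^3^3) = N \<longleftrightarrow>
     M$1$1 = N$1$1 \<and> M$1$2 = N$1$2 \<and> M$1$3 = N$1$3 \<and>
     M$2$1 = N$2$1 \<and> M$2$2 = N$2$2 \<and> M$2$3 = N$2$3 \<and>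
     M$3$1 = N$3$1 \<and> M$3$2 = N$3$2 \<and> M$3$3 = N$3$3"
  by (auto simp: vec_eq_iff forall_3)

lemma vec3_eq_iff_entries: "(x::'a^3) = y \<longleftrightarrow> x$1 = y$1 \<and> x$2 = y$2 \<and> x$3 = y$3"
  by (auto simp: vec_eq_iff forall_3)

lemma mat3_cases:
  fixes M :: "'a::zero^3^3"
  obtains a11 a12 a13 a21 a22 a23 a31 a32 a33 where "M = mat3 a11 a12 a13 a21 a22 a23 a31 a32 a33"
  by (metis (no_types) mat3_eq_iff_entries mat3_nth)

lemma vec3_cases:
  fixes x :: "'a::zero^3"
  obtains a b c where "x = vec3 a b c"
  by (metis (no_types) vec3_eq_iff_entries vec3_nth)

lemma mat3_eq_iff [simp]:
  "mat3 a11 a12 a13 a21 a22 a23 a31 a32 a33 = mat3 b11 b12 b13 b21 b22 b23 b31 b32 b33 \<longleftrightarrow>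
   a11 = b11 \<and> a12 = b12 \<and> a13 = b13 \<and> a21 = b21 \<and> a22 = b22 \<and> a23 = b23 \<and>
   a31 = b31 \<and> a32 = b32 \<and> a33 = b33"
  by (simp add: mat3_eq_iff_entries)

lemma vec3_eq_iff [simp]: "vec3 a b c = vec3 a' b' c' \<longleftrightarrow> a = a' \<and> b = b' \<and> c = c'"
  by (simp add: vec3_eq_iff_entries)

lemma mat_eq_mat3: "(mat k :: 'a::zero^3^3) = mat3 k 0 0 0 k 0 0 0 k"
  by (simp add: mat3_eq_iff_entries mat_def)

lemma zero_eq_mat3: "(0 :: 'a::zero^3^3) = mat3 0 0 0 0 0 0 0 0 0"
  by (simp add: mat3_eq_iff_entries)

lemma zero_eq_vec3: "(0 :: 'a::zero^3) = vec3 0 0 0"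
  by (simp add: vec3_eq_iff_entries)

lemma vec3_eq_0_iff [simp]: "vec3 a b c = 0 \<longleftrightarrow> a = 0 \<and> b = 0 \<and> c = 0"
  by (simp add: vec3_eq_iff_entries)

lemma mat3_mult [simp]:
  "mat3 a11 a12 a13 a21 a22 a23 a31 a32 a33 ** mat3 b11 b12 b13 b21 b22 b23 b31 b32 b33 =
   mat3 (a11*b11 + a12*b21 + a13*b31) (a11*b12 + a12*b22 + a13*b32) (a11*b13 + a12*b23 + a13*b33)
        (a21*b11 + a22*b21 + a23*b31) (a21*b12 + a22*b22 + a23*b32) (a21*b13 + a22*b23 + a23*b33)
        (a31*b11 + a32*b21 + a33*b31) (a31*b12 + a32*b22 + a33*b32) (a31*b13 + a32*b23 + a33*b33)"
  by (simp add: mat3_eq_iff_entries matrix_matrix_mult_def sum_3)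

lemma mat3_mult_vec3 [simp]:
  "mat3 a11 a12 a13 a21 a22 a23 a31 a32 a33 *v vec3 x y z =
   vec3 (a11*x + a12*y + a13*z) (a21*x + a22*y + a23*z) (a31*x + a32*y + a33*z)"
  by (simp add: vec3_eq_iff_entries matrix_vector_mult_def sum_3)

lemma matrix_vector_mult_e1: "(M::'a::comm_semiring_1^3^3) *v vec3 1 0 0 = vec3 (M$1$1) (M$2$1) (M$3$1)"
  by (cases M rule: mat3_cases) simp

lemma mat3_diff [simp]:
  "mat3 a11 a12 a13 a21 a22 a23 a31 a32 a33 - mat3 b11 b12 b13 b21 b22 b23 b31 b32 b33 =
   mat3 (a11-b11) (a12-b12) (a13-b13) (a21-b21) (a22-b22) (a23-b23) (a31-b31) (a32-b32) (a33-b33)"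
  by (simp add: mat3_eq_iff_entries)

lemma vec3_add [simp]: "vec3 a b c + vec3 a' b' c' = vec3 (a + a') (b + b') (c + c')"
  by (simp add: vec3_eq_iff_entries)

lemma vec3_scale [simp]: "k *s vec3 a b c = vec3 (k * a) (k * b) (k * c)"
  by (simp add: vec3_eq_iff_entries)

lemma transpose_mat3 [simp]:
  "transpose (mat3 a11 a12 a13 a21 a22 a23 a31 a32 a33) = mat3 a11 a21 a31 a12 a22 a32 a13 a23 a33"
  by (simp add: mat3_eq_iff_entries transpose_def)

lemma det_mat3 [simp]:
  "det (mat3 a11 a12 a13 a21 a22 a23 a31 a32 a33) =
     a11*a22*a33 + a12*a23*a31 + a13*a21*a32 - a11*a23*a32 - a12*a21*a33 - a13*a22*a31"
  by (simp add: det_3)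

lemma mat3_map_entries:
  "((\<chi> i j. f (M $ i $ j)) :: 'b::zero^3^3) =
     mat3 (f (M$1$1)) (f (M$1$2)) (f (M$1$3)) (f (M$2$1)) (f (M$2$2)) (f (M$2$3))
          (f (M$3$1)) (f (M$3$2)) (f (M$3$3))"
  by (simp add: mat3_eq_iff_entries)

definition adjugate3 :: "'a::comm_ring_1^3^3 \<Rightarrow> 'a^3^3" where
  "adjugate3 M =
     mat3 (M$2$2*M$3$3 - M$2$3*M$3$2) (M$1$3*M$3$2 - M$1$2*M$3$3) (M$1$2*M$2$3 - M$1$3*M$2$2)
          (M$2$3*M$3$1 - M$2$1*M$3$3) (M$1$1*M$3$3 - M$1$3*M$3$1) (M$1$3*M$2$1 - M$1$1*M$2$3)
          (M$2$1*M$3$2 - M$2$2*M$3$1) (M$1$2*M$3$1 - M$1$1*M$3$2) (M$1$1*M$2$2 - M$1$2*M$2$1)"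

lemma adjugate3_mat3 [simp]:
  "adjugate3 (mat3 a11 a12 a13 a21 a22 a23 a31 a32 a33) =
     mat3 (a22*a33 - a23*a32) (a13*a32 - a12*a33) (a12*a23 - a13*a22)
          (a23*a31 - a21*a33) (a11*a33 - a13*a31) (a13*a21 - a11*a23)
          (a21*a32 - a22*a31) (a12*a31 - a11*a32) (a11*a22 - a12*a21)"
  by (simp add: adjugate3_def)

lemma adjugate3_mult: "adjugate3 M ** M = mat (det M)"
  by (cases M rule: mat3_cases) (simp add: mat_eq_mat3 algebra_simps)

lemma mult_adjugate3: "M ** adjugate3 M = mat (det M)"
  by (cases M rule: mat3_cases) (simp add: mat_eq_mat3 algebra_simps)

lemma det_one_adjugate3_inverse:
  assumes "det M = 1"
  shows "adjugate3 M ** M = mat 1" "M ** adjugate3 M = mat 1"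
  using assms by (simp_all add: adjugate3_mult mult_adjugate3)

lemma has_eigenvalue_one_det:
  fixes M :: "int^3^3"
  assumes "has_eigenvalue_one M"
  shows "det (M - mat 1) = 0"
proof -
  obtain v :: "complex^3" where v: "v \<noteq> 0" "(\<chi> i j. of_int (M$i$j)) *v v = v"
    using assms unfolding has_eigenvalue_one_def by blast
  define C :: "complex^3^3" where "C = (\<chi> i j. of_int (M$i$j)) - mat 1"
  have "C *v v = 0"
    using v(2) by (simp add: C_def matrix_vector_mult_diff_rdistrib)
  then have "mat (det C) *v v = 0"
    by (simp flip: adjugate3_mult matrix_vector_mul_assoc)
  then have "det C = 0"
    using v(1) by (cases v rule: vec3_cases) (auto simp: mat_eq_mat3)
  moreover have "det C = of_int (det (M - mat 1))"
    by (cases M rule: mat3_cases) (simp add: C_def mat3_map_entries mat_eq_mat3)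
  ultimately show ?thesis by simp
qed

section \<open>Cross products and primitive vectors\<close>

definition cross :: "'a::comm_ring_1^3 \<Rightarrow> 'a^3 \<Rightarrow> 'a^3" where
  "cross a b = vec3 (a$2*b$3 - a$3*b$2) (a$3*b$1 - a$1*b$3) (a$1*b$2 - a$2*b$1)"

definition dot :: "'a::comm_ring_1^3 \<Rightarrow> 'a^3 \<Rightarrow> 'a" where
  "dot a b = a$1*b$1 + a$2*b$2 + a$3*b$3"

lemma cross_vec3 [simp]:
  "cross (vec3 a1 a2 a3) (vec3 b1 b2 b3) = vec3 (a2*b3 - a3*b2) (a3*b1 - a1*b3) (a1*b2 - a2*b1)"
  by (simp add: cross_def)

lemma dot_vec3 [simp]: "dot (vec3 a1 a2 a3) (vec3 b1 b2 b3) = a1*b1 + a2*b2 + a3*b3"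
  by (simp add: dot_def)

lemma dot_commute: "dot a b = dot b a"
  by (simp add: dot_def algebra_simps)

lemma cross_refl [simp]: "cross a a = 0"
  by (cases a rule: vec3_cases) (simp add: algebra_simps)

lemma cross_zero_right [simp]: "cross a 0 = 0"
  by (cases a rule: vec3_cases) (simp add: zero_eq_vec3)

lemma cross_scale_left: "cross (k *s a) b = k *s cross a b"
  by (cases a rule: vec3_cases, cases b rule: vec3_cases) (simp add: algebra_simps)

lemma cross_scale_right: "cross a (k *s b) = k *s cross a b"
  by (cases a rule: vec3_cases, cases b rule: vec3_cases) (simp add: algebra_simps)

lemma cross_cross: "cross r (cross a b) = dot r b *s a - dot r a *s b"
  by (cases r rule: vec3_cases, cases a rule: vec3_cases, cases b rule: vec3_cases)
     (simp add: algebra_simps)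

lemma dot_self_pos:
  fixes a :: "'a::linordered_idom^3"
  assumes "a \<noteq> 0"
  shows "dot a a > 0"
proof (cases a rule: vec3_cases)
  case (1 x y z)
  show ?thesis
  proof (cases "x = 0 \<and> y = 0")
    case True
    with assms 1 have "z \<noteq> 0" by auto
    with True 1 show ?thesis by (auto simp: zero_less_mult_iff linorder_neq_iff)
  next
    case False
    then have "0 < x * x + y * y" by (simp add: sum_squares_gt_zero_iff)
    then show ?thesis by (simp add: 1 add_pos_nonneg)
  qed
qed

lemma cross_matrix_mult: "cross (M *v a) (M *v b) = transpose (adjugate3 M) *v cross a b"
  by (cases M rule: mat3_cases, cases a rule: vec3_cases, cases b rule: vec3_cases)
     (simp add: algebra_simps)

lemma cross_eq_0_if_orthogonal:
  fixes a b r r' :: "'a::linordered_idom^3"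
  assumes "dot r a = 0" "dot r b = 0" "dot r' a = 0" "dot r' b = 0" "cross a b \<noteq> 0"
  shows "cross r r' = 0"
proof -
  define w where "w = cross a b"
  have parallel: "dot w w *s s = dot s w *s w" if "dot s a = 0" "dot s b = 0" for s
  proof -
    have "cross s w = 0" unfolding w_def cross_cross using that by simp
    then have "cross w (cross s w) = 0" by simp
    then show ?thesis unfolding cross_cross by (simp add: dot_commute)
  qed
  have "(dot w w * dot w w) *s cross r r' = cross (dot w w *s r) (dot w w *s r')"
    by (simp add: cross_scale_left cross_scale_right)
  also have "\<dots> = cross (dot r w *s w) (dot r' w *s w)"
    using parallel assms by simp
  also have "\<dots> = 0"
    by (simp add: cross_scale_left cross_scale_right)
  finally show ?thesis
    using dot_self_pos[of w] assms(5) by (simp add: w_def)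
qed

text \<open>A nonzero adjugate means rank at least two, hence a kernel of dimension at most one.\<close>

lemma kernel_cross_eq_0:
  fixes M :: "'a::linordered_idom^3^3"
  assumes "M *v a = 0" "M *v b = 0" "adjugate3 M \<noteq> 0"
  shows "cross a b = 0"
proof (rule ccontr)
  assume ab: "cross a b \<noteq> 0"
  obtain m11 m12 m13 m21 m22 m23 m31 m32 m33 where
    M: "M = mat3 m11 m12 m13 m21 m22 m23 m31 m32 m33" by (rule mat3_cases)
  obtain a1 a2 a3 b1 b2 b3 where a: "a = vec3 a1 a2 a3" and b: "b = vec3 b1 b2 b3"
    by (meson vec3_cases)
  define r1 r2 r3 where "r1 = vec3 m11 m12 m13" "r2 = vec3 m21 m22 m23" "r3 = vec3 m31 m32 m33"
  have "dot r1 a = 0" "dot r2 a = 0" "dot r3 a = 0" "dot r1 b = 0" "dot r2 b = 0" "dot r3 b = 0"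
    using assms(1,2) by (simp_all add: M a b r1_r2_r3_def zero_eq_vec3)
  then have "cross r1 r2 = 0" "cross r2 r3 = 0" "cross r3 r1 = 0"
    using cross_eq_0_if_orthogonal ab by blast+
  then have "adjugate3 M = 0"
    by (simp add: M r1_r2_r3_def zero_eq_mat3 zero_eq_vec3) (simp add: algebra_simps)
  with assms(3) show False by simp
qed

lemma int_pair_primitive:
  fixes x y :: int
  obtains g x' y' \<alpha> \<beta> where "x = g * x'" "y = g * y'" "\<alpha> * x' + \<beta> * y' = 1"
proof (cases "x = 0 \<and> y = 0")
  case True
  then show ?thesis using that[of 0 0 1 0 1] by simp
next
  case False
  define g where "g = gcd x y"
  have "g \<noteq> 0" using False by (simp add: g_def)
  obtain x' y' where xy: "x = g * x'" "y = g * y'"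
    unfolding g_def by (meson dvdE gcd_dvd1 gcd_dvd2)
  obtain \<alpha> \<beta> where "\<alpha> * x + \<beta> * y = g"
    using bezout_int g_def by blast
  then have "g * (\<alpha> * x' + \<beta> * y') = g * 1"
    by (simp add: xy algebra_simps)
  then show ?thesis
    using that xy \<open>g \<noteq> 0\<close> by (metis mult_left_cancel)
qed

lemma int_vec3_primitive:
  fixes v :: "int^3"
  assumes "v \<noteq> 0"
  obtains g f u where "g \<noteq> 0" "v = g *s f" "dot u f = 1"
proof -
  obtain a b c where v: "v = vec3 a b c" by (rule vec3_cases)
  obtain g1 a' b' \<alpha> \<beta> where ab: "a = g1 * a'" "b = g1 * b'" "\<alpha> * a' + \<beta> * b' = 1"
    by (rule int_pair_primitive)
  obtain g g1' c' \<gamma> \<delta> where gc: "g1 = g * g1'" "c = g * c'" "\<gamma> * g1' + \<delta> * c' = 1"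
    by (rule int_pair_primitive)
  have f: "v = g *s vec3 (g1' * a') (g1' * b') c'"
    by (simp add: v ab gc)
  have "dot (vec3 (\<gamma> * \<alpha>) (\<gamma> * \<beta>) \<delta>) (vec3 (g1' * a') (g1' * b') c') =
      \<gamma> * g1' * (\<alpha> * a' + \<beta> * b') + \<delta> * c'"
    by (simp add: algebra_simps)
  also have "\<dots> = 1"
    using ab(3) gc(3) by simp
  finally have u: "dot (vec3 (\<gamma> * \<alpha>) (\<gamma> * \<beta>) \<delta>) (vec3 (g1' * a') (g1' * b') c') = 1" .
  have "g \<noteq> 0"
    using assms f by auto
  then show ?thesis using f u by (rule that)
qed

lemma unimodular_completion:
  fixes f u :: "int^3"
  assumes "dot u f = 1"
  obtains P where "det P = 1" "P *v vec3 1 0 0 = f"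
proof -
  obtain p q r where f: "f = vec3 p q r" by (rule vec3_cases)
  obtain u1 u2 u3 where u: "u = vec3 u1 u2 u3" by (rule vec3_cases)
  obtain d q' r' x y where qr: "q = d * q'" "r = d * r'" "x * q' + y * r' = 1"
    by (rule int_pair_primitive)
  define b where "b = u2 * q' + u3 * r'"
  have pd: "u1 * p + b * d = 1"
    using assms by (simp add: f u qr b_def algebra_simps)
  define P where "P = mat3 p (-b) 0 q (u1 * q') (-y) r (u1 * r') x"
  have "det P = (u1 * p + b * d) * (x * q' + y * r')"
    by (simp add: P_def qr algebra_simps)
  then have "det P = 1" using pd qr(3) by simp
  moreover have "P *v vec3 1 0 0 = f" by (simp add: P_def f)
  ultimately show ?thesis using that by blast
qed

section \<open>Commutative groups of integer matrices with eigenvalue one\<close>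

locale spectrally_unitary_group =
  fixes S :: "(int^3^3) set"
  assumes one_mem: "mat 1 \<in> S"
    and mult_mem: "h \<in> S \<Longrightarrow> k \<in> S \<Longrightarrow> h ** k \<in> S"
    and mult_commute: "h \<in> S \<Longrightarrow> k \<in> S \<Longrightarrow> h ** k = k ** h"
    and inverse_ex: "h \<in> S \<Longrightarrow> \<exists>k\<in>S. k ** h = mat 1"
    and det_minus_one: "h \<in> S \<Longrightarrow> det (h - mat 1) = 0"
    and common_fixed_zero: "(\<And>h. h \<in> S \<Longrightarrow> h *v v = v) \<Longrightarrow> v = 0"

lemma spectrally_unitary_group_conj:
  assumes "spectrally_unitary_group S" "H ** Hinv = mat 1" "Hinv ** H = mat 1"
  shows "spectrally_unitary_group ((\<lambda>h. H ** h ** Hinv) ` S)"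
proof -
  interpret spectrally_unitary_group S by fact
  let ?c = "\<lambda>h. H ** h ** Hinv"
  have c_mult: "?c h ** ?c k = ?c (h ** k)" for h k
    using conj_mult[OF assms(3)] .
  show ?thesis
  proof
    show "mat 1 \<in> ?c ` S"
    proof (rule image_eqI)
      show "mat 1 = ?c (mat 1)" using assms(2) by simp
    qed (rule one_mem)
  next
    fix x y assume "x \<in> ?c ` S" "y \<in> ?c ` S"
    then obtain h k where hk: "h \<in> S" "k \<in> S" "x = ?c h" "y = ?c k" by blast
    show "x ** y \<in> ?c ` S"
      using hk mult_mem by (simp add: c_mult)
    show "x ** y = y ** x"
      using hk mult_commute by (simp add: c_mult)
  next
    fix x assume "x \<in> ?c ` S"
    then obtain h where h: "h \<in> S" "x = ?c h" by blast
    then obtain k where k: "k \<in> S" "k ** h = mat 1" using inverse_ex by blast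
    then have "?c k ** x = mat 1" using h assms(2) by (simp add: c_mult)
    with k(1) show "\<exists>y\<in>?c ` S. y ** x = mat 1" by blast
    have "x - mat 1 = H ** (h - mat 1) ** Hinv"
      using h assms(2) by (simp add: matrix_mult_diff_left matrix_mult_diff_right)
    then show "det (x - mat 1) = 0" using det_minus_one h by (simp add: det_mul)
  next
    fix v assume fixed: "\<And>x. x \<in> ?c ` S \<Longrightarrow> x *v v = v"
    have "h *v (Hinv *v v) = Hinv *v v" if "h \<in> S" for h
    proof -
      have "Hinv ** ?c h = (Hinv ** H) ** h ** Hinv" by (simp add: matrix_mul_assoc)
      then have "Hinv ** ?c h = h ** Hinv" using assms(3) by simp
      then have "Hinv *v (?c h *v v) = h *v (Hinv *v v)"
        by (simp add: matrix_vector_mul_assoc)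
      then show ?thesis using fixed that by simp
    qed
    then have "Hinv *v v = 0" by (rule common_fixed_zero)
    then have "(H ** Hinv) *v v = 0" by (simp flip: matrix_vector_mul_assoc)
    then show "v = 0" using assms(2) by simp
  qed
qed

context spectrally_unitary_group
begin

lemma ex_not_fixing:
  assumes "v \<noteq> 0"
  obtains h where "h \<in> S" "h *v v \<noteq> v"
  using common_fixed_zero assms by blast

lemma common_eigenvector:
  obtains v where "v \<noteq> 0" "\<And>h. h \<in> S \<Longrightarrow> cross (h *v v) v = 0"
proof -
  obtain s where s: "s \<in> S" "s *v vec3 1 0 0 \<noteq> vec3 1 0 0"
    using ex_not_fixing[of "vec3 1 0 0"] by auto
  define M where "M = s - mat 1"
  have "M \<noteq> 0"
  proof
    assume "M = 0"
    then have "s = mat 1" by (simp add: M_def)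
    with s(2) show False by simp
  qed
  have "det M = 0"
    using det_minus_one s(1) by (simp add: M_def)
  have M_commute: "M *v (h *v x) = h *v (M *v x)" if "h \<in> S" for h x
  proof -
    have "h ** M = M ** h"
      using mult_commute[OF that s(1)]
      by (simp add: M_def matrix_mult_diff_left matrix_mult_diff_right)
    then show ?thesis by (simp add: matrix_vector_mul_assoc)
  qed
  show ?thesis
  proof (cases "adjugate3 M = 0")
    case True
    text \<open>$M$ has rank one, and its image is an invariant line.\<close>
    obtain x where x: "M *v x \<noteq> 0"
      using \<open>M \<noteq> 0\<close> matrix_eq[of M 0] by auto
    have "cross (h *v (M *v x)) (M *v x) = 0" if "h \<in> S" for h
      using M_commute[OF that, of x, symmetric] by (simp add: cross_matrix_mult True)
    with x show ?thesis by (rule that)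
  next
    case False
    text \<open>$M$ has rank two, and its kernel is an invariant line.\<close>
    obtain x where x: "adjugate3 M *v x \<noteq> 0"
      using False matrix_eq[of "adjugate3 M" 0] by auto
    have ker: "M *v (adjugate3 M *v x) = 0"
      by (simp add: matrix_vector_mul_assoc mult_adjugate3 \<open>det M = 0\<close>)
    have "cross (h *v (adjugate3 M *v x)) (adjugate3 M *v x) = 0" if "h \<in> S" for h
      using M_commute[OF that, of "adjugate3 M *v x"] ker False
      by (intro kernel_cross_eq_0) simp_all
    with x show ?thesis by (rule that)
  qed
qed

lemma conj_first_column_zero:
  obtains H Hinv :: "int^3^3" where "H ** Hinv = mat 1" "Hinv ** H = mat 1"
    "\<And>h. h \<in> S \<Longrightarrow> (H ** h ** Hinv)$2$1 = 0 \<and> (H ** h ** Hinv)$3$1 = 0"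
proof -
  obtain v where v: "v \<noteq> 0" "\<And>h. h \<in> S \<Longrightarrow> cross (h *v v) v = 0"
    using common_eigenvector by blast
  obtain g f u where gfu: "g \<noteq> 0" "v = g *s f" "dot u f = 1"
    using int_vec3_primitive[OF v(1)] by blast
  have eigen: "h *v f = dot u (h *v f) *s f" if "h \<in> S" for h
  proof -
    have "(g * g) *s cross (h *v f) f = 0"
      using v(2)[OF that] by (simp add: gfu(2) matrix_vector_mult_scale cross_scale_left cross_scale_right)
    then have "cross u (cross (h *v f) f) = 0"
      using gfu(1) by (simp add: vector_mul_eq_0)
    then show ?thesis
      using gfu(3) by (simp add: cross_cross)
  qed
  obtain P where P: "det P = 1" "P *v vec3 1 0 0 = f"
    using unimodular_completion[OF gfu(3)] by blast
  note P_inv = det_one_adjugate3_inverse[OF P(1)]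
  have "(adjugate3 P ** h ** P)$2$1 = 0 \<and> (adjugate3 P ** h ** P)$3$1 = 0" if "h \<in> S" for h
  proof -
    have "(adjugate3 P ** h ** P) *v vec3 1 0 0 = adjugate3 P *v (h *v f)"
      using P(2) by (simp flip: matrix_vector_mul_assoc)
    also have "\<dots> = dot u (h *v f) *s (adjugate3 P *v f)"
      using eigen[OF that] by (metis matrix_vector_mult_scale)
    also have "adjugate3 P *v f = vec3 1 0 0"
      using P(2) P_inv(1) by (metis matrix_vector_mul_assoc matrix_vector_mul_lid)
    finally show ?thesis
      by (simp add: matrix_vector_mult_e1)
  qed
  with P_inv show ?thesis by (intro that[of "adjugate3 P" P]) auto
qed

end

section \<open>Triangularization\<close>

lemma singular2_kernel:
  fixes m11 m12 m21 m22 :: "'a::comm_ring_1"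
  assumes "m11 * m22 - m12 * m21 = 0"
  obtains x y where "x \<noteq> 0 \<or> y \<noteq> 0" "m11 * x + m12 * y = 0" "m21 * x + m22 * y = 0"
proof -
  consider "m22 \<noteq> 0 \<or> m21 \<noteq> 0" | "m12 \<noteq> 0 \<or> m11 \<noteq> 0" | "m11 = 0" "m12 = 0" "m21 = 0" "m22 = 0"
    by blast
  then show ?thesis
  proof cases
    case 1
    with assms show ?thesis by (intro that[of m22 "- m21"]) (auto simp: algebra_simps)
  next
    case 2
    with assms show ?thesis by (intro that[of "- m12" m11]) (auto simp: algebra_simps)
  next
    case 3
    then show ?thesis by (intro that[of 1 0]) auto
  qed
qed

lemma kernel2_parallel:
  fixes m11 m12 m21 m22 u1 u2 w1 w2 :: "'a::idom"
  assumes "m11 * u1 + m12 * u2 = 0" "m21 * u1 + m22 * u2 = 0"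
    and "m11 * w1 + m12 * w2 = 0" "m21 * w1 + m22 * w2 = 0"
    and "m11 \<noteq> 0 \<or> m12 \<noteq> 0 \<or> m21 \<noteq> 0 \<or> m22 \<noteq> 0"
  shows "u1 * w2 - u2 * w1 = 0"
proof -
  have "m11 * (u1 * w2 - u2 * w1) = 0" "m12 * (u1 * w2 - u2 * w1) = 0"
    "m21 * (u1 * w2 - u2 * w1) = 0" "m22 * (u1 * w2 - u2 * w1) = 0"
    using assms(1-4) by algebra+
  with assms(5) show ?thesis by auto
qed

definition block_is_one :: "int^3^3 \<Rightarrow> bool" where
  "block_is_one h \<longleftrightarrow> h$2$2 = 1 \<and> h$2$3 = 0 \<and> h$3$2 = 0 \<and> h$3$3 = 1"

definition block_det :: "int^3^3 \<Rightarrow> int" where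
  "block_det h = (h$2$2 - 1) * (h$3$3 - 1) - h$2$3 * h$3$2"

locale block_triangular_group = spectrally_unitary_group +
  assumes first_column_zero: "h \<in> S \<Longrightarrow> h$2$1 = 0 \<and> h$3$1 = 0"
begin

lemma block_cases:
  assumes "h \<in> S"
  obtains t a b p q r s where "h = mat3 t a b 0 p q 0 r s"
  using first_column_zero[OF assms] by (cases h rule: mat3_cases) auto

lemma det_minus_one_block:
  assumes "h \<in> S"
  shows "(h$1$1 - 1) * block_det h = 0"
proof -
  obtain t a b p q r s where h: "h = mat3 t a b 0 p q 0 r s"
    using block_cases[OF assms] .
  have "det (h - mat 1) = (t - 1) * ((p - 1) * (s - 1) - q * r)"
    by (simp add: h mat_eq_mat3 algebra_simps)
  with det_minus_one[OF assms] show ?thesis by (simp add: h block_det_def)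
qed

lemma ex_corner_not_one:
  obtains \<sigma> where "\<sigma> \<in> S" "\<sigma>$1$1 \<noteq> 1"
proof -
  obtain \<sigma> where "\<sigma> \<in> S" "\<sigma> *v vec3 1 0 0 \<noteq> vec3 1 0 0"
    using ex_not_fixing[of "vec3 1 0 0"] by auto
  with first_column_zero show ?thesis
    by (intro that[of \<sigma>]) (auto simp: matrix_vector_mult_e1)
qed

lemma common_block_eigenvector_of_singular:
  assumes k: "k \<in> S" "\<not> block_is_one k" "block_det k = 0"
  obtains x y where "x \<noteq> 0 \<or> y \<noteq> 0"
    "\<And>h. h \<in> S \<Longrightarrow> (h$2$2 * x + h$2$3 * y) * y - (h$3$2 * x + h$3$3 * y) * x = 0"
proof -
  obtain t' a' b' p' q' r' s' where k_eq: "k = mat3 t' a' b' 0 p' q' 0 r' s'"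
    using block_cases[OF k(1)] .
  have singular: "(p' - 1) * (s' - 1) - q' * r' = 0"
    using k(3) by (simp add: k_eq block_det_def)
  have nonzero: "p' - 1 \<noteq> 0 \<or> q' \<noteq> 0 \<or> r' \<noteq> 0 \<or> s' - 1 \<noteq> 0"
    using k(2) by (auto simp: k_eq block_is_one_def)
  obtain x y where xy: "x \<noteq> 0 \<or> y \<noteq> 0" "(p' - 1) * x + q' * y = 0" "r' * x + (s' - 1) * y = 0"
    using singular2_kernel[OF singular] by blast
  have "(h$2$2 * x + h$2$3 * y) * y - (h$3$2 * x + h$3$3 * y) * x = 0" if hS: "h \<in> S" for h
  proof -
    obtain t a b p q r s where h: "h = mat3 t a b 0 p q 0 r s"
      using block_cases[OF hS] .
    have "h ** k = k ** h"
      using mult_commute[OF hS k(1)] .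
    then have comm: "p * p' + q * r' = p' * p + q' * r" "p * q' + q * s' = p' * q + q' * s"
      "r * p' + s * r' = r' * p + s' * r" "r * q' + s * s' = r' * q + s' * s"
      by (simp_all add: h k_eq)
    text \<open>The block of $h$ maps the kernel of the block of $k - 1$ into itself.\<close>
    have "(p' - 1) * (p * x + q * y) + q' * (r * x + s * y) = 0"
      "r' * (p * x + q * y) + (s' - 1) * (r * x + s * y) = 0"
      using comm xy(2,3) by algebra+
    from kernel2_parallel[OF this xy(2,3) nonzero] show ?thesis
      by (simp add: h)
  qed
  with xy(1) show ?thesis by (rule that)
qed

lemma blocks_one_if_singular_blocks_one:
  assumes "\<And>k. k \<in> S \<Longrightarrow> block_det k = 0 \<Longrightarrow> block_is_one k" "h \<in> S"
  shows "block_is_one h"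
proof -
  have corner: "block_is_one g" if "g \<in> S" "g$1$1 \<noteq> 1" for g
  proof -
    have "block_det g = 0"
      using det_minus_one_block[OF that(1)] that(2) by simp
    with assms(1) that(1) show ?thesis by blast
  qed
  obtain \<sigma> where \<sigma>: "\<sigma> \<in> S" "\<sigma>$1$1 \<noteq> 1"
    by (rule ex_corner_not_one)
  show ?thesis
  proof (cases "h$1$1 = 1")
    case True
    text \<open>Then $\sigma h$ has corner entry different from $1$ and the same block as $h$.\<close>
    obtain t a b p q r s where h: "h = mat3 t a b 0 p q 0 r s"
      using block_cases[OF assms(2)] .
    obtain t' a' b' p' q' r' s' where \<sigma>_eq: "\<sigma> = mat3 t' a' b' 0 p' q' 0 r' s'"
      using block_cases[OF \<sigma>(1)] .
    have "block_is_one \<sigma>" using corner \<sigma> .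
    moreover have "block_is_one (\<sigma> ** h)"
      using corner mult_mem[OF \<sigma>(1) assms(2)] \<sigma>(2) True by (simp add: h \<sigma>_eq)
    ultimately show ?thesis
      by (simp add: h \<sigma>_eq block_is_one_def)
  next
    case False
    with assms(2) show ?thesis by (rule corner)
  qed
qed

lemma common_block_eigenvector:
  obtains x y where "x \<noteq> 0 \<or> y \<noteq> 0"
    "\<And>h. h \<in> S \<Longrightarrow> (h$2$2 * x + h$2$3 * y) * y - (h$3$2 * x + h$3$3 * y) * x = 0"
proof (cases "\<exists>k\<in>S. \<not> block_is_one k \<and> block_det k = 0")
  case True
  then show ?thesis
    using common_block_eigenvector_of_singular that by blast
next
  case False
  then have "block_is_one h" if "h \<in> S" for h
    using blocks_one_if_singular_blocks_one that by blast
  then show ?thesis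
    by (intro that[of 1 0]) (auto simp: block_is_one_def)
qed

lemma conj_lower_triangular:
  obtains H Hinv :: "int^3^3" where "H ** Hinv = mat 1" "Hinv ** H = mat 1"
    "\<And>h. h \<in> S \<Longrightarrow>
       (H ** h ** Hinv)$2$1 = 0 \<and> (H ** h ** Hinv)$3$1 = 0 \<and> (H ** h ** Hinv)$3$2 = 0"
proof -
  obtain x y where xy: "x \<noteq> 0 \<or> y \<noteq> 0"
    "\<And>h. h \<in> S \<Longrightarrow> (h$2$2 * x + h$2$3 * y) * y - (h$3$2 * x + h$3$3 * y) * x = 0"
    using common_block_eigenvector by blast
  obtain g x' y' \<alpha> \<beta> where g: "x = g * x'" "y = g * y'" "\<alpha> * x' + \<beta> * y' = 1"
    by (rule int_pair_primitive)
  have "g \<noteq> 0" using xy(1) g by auto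
  have eigen: "(h$2$2 * x' + h$2$3 * y') * y' - (h$3$2 * x' + h$3$3 * y') * x' = 0" if "h \<in> S" for h
  proof -
    have "(g * g) * ((h$2$2 * x' + h$2$3 * y') * y' - (h$3$2 * x' + h$3$3 * y') * x') = 0"
      using xy(2)[OF that] by (simp add: g algebra_simps)
    with \<open>g \<noteq> 0\<close> show ?thesis by simp
  qed
  define P where "P = mat3 1 0 0 0 x' (- \<beta>) 0 y' \<alpha>"
  have "det P = 1" using g(3) by (simp add: P_def algebra_simps)
  note P_inv = det_one_adjugate3_inverse[OF this]
  have "(adjugate3 P ** h ** P)$2$1 = 0 \<and> (adjugate3 P ** h ** P)$3$1 = 0 \<and>
      (adjugate3 P ** h ** P)$3$2 = 0" if hS: "h \<in> S" for h
  proof -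
    obtain t a b p q r s where h: "h = mat3 t a b 0 p q 0 r s"
      using block_cases[OF hS] .
    have "(adjugate3 P ** h ** P)$3$2 = - ((p * x' + q * y') * y' - (r * x' + s * y') * x')"
      by (simp add: P_def h algebra_simps)
    with eigen[OF hS] show ?thesis by (simp add: P_def h)
  qed
  with P_inv show ?thesis by (intro that[of "adjugate3 P" P]) auto
qed

end

section \<open>The Klein four-group of upper triangular matrices\<close>

definition klein_gen1 :: "int \<Rightarrow> int \<Rightarrow> int^3^3" where
  "klein_gen1 a b = mat3 1 a b 0 (-1) 0 0 0 (-1)"

definition klein_gen2 :: "int \<Rightarrow> int \<Rightarrow> int^3^3" where
  "klein_gen2 c d = mat3 (-1) 0 c 0 (-1) d 0 0 1"

definition klein_matrices :: "int \<Rightarrow> int \<Rightarrow> int \<Rightarrow> int \<Rightarrow> (int^3^3) set" where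
  "klein_matrices a b c d = {mat 1, klein_gen1 a b, klein_gen2 c d, klein_gen1 a b ** klein_gen2 c d}"

lemma klein_matrices_square:
  assumes "a * d + 2 * (b + c) = 0" "M \<in> klein_matrices a b c d"
  shows "M ** M = mat 1"
proof -
  have "(klein_gen1 a b ** klein_gen2 c d) ** (klein_gen1 a b ** klein_gen2 c d) =
      mat3 1 0 (- (a * d + 2 * (b + c))) 0 1 0 0 0 1"
    by (simp add: klein_gen1_def klein_gen2_def algebra_simps)
  with assms show ?thesis
    by (auto simp: klein_matrices_def klein_gen1_def klein_gen2_def mat_eq_mat3)
qed

lemma klein_matrices_iso: "\<lparr>carrier = klein_matrices a b c d, mult = (**), one = mat 1\<rparr> \<cong> Klein_four"
proof (rule is_isoI, rule isoI)
  let ?K = "\<lparr>carrier = klein_matrices a b c d, mult = (**), one = mat 1\<rparr>"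
  text \<open>An element of the Klein matrix group is determined by the signs of two diagonal entries.\<close>
  define \<psi> :: "int^3^3 \<Rightarrow> int \<times> int"
    where "\<psi> M = (if M$1$1 = 1 then 0 else 1, if M$3$3 = 1 then 0 else 1)" for M
  have carrier_K4: "carrier Klein_four = {0, 1} \<times> {0, 1}"
    by (auto simp: Klein_four_def carrier_integer_mod_group)
  have mult_K4: "x \<otimes>\<^bsub>Klein_four\<^esub> y = ((fst x + fst y) mod 2, (snd x + snd y) mod 2)" for x y
    by (simp add: Klein_four_def mult_DirProd')
  have \<psi>_values: "\<psi> (mat 1) = (0, 0)" "\<psi> (klein_gen1 a b) = (0, 1)" "\<psi> (klein_gen2 c d) = (1, 0)"
    "\<psi> (klein_gen1 a b ** klein_gen2 c d) = (1, 1)"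
    by (simp_all add: \<psi>_def klein_gen1_def klein_gen2_def mat_eq_mat3)
  have lower: "M$2$1 = 0" "M$3$1 = 0" "M$3$2 = 0"
    and signs: "M$1$1 = 1 \<or> M$1$1 = -1" "M$3$3 = 1 \<or> M$3$3 = -1" if "M \<in> klein_matrices a b c d" for M
    using that by (auto simp: klein_matrices_def klein_gen1_def klein_gen2_def mat_eq_mat3)
  have diag_mult: "(M ** N)$1$1 = M$1$1 * N$1$1" "(M ** N)$3$3 = M$3$3 * N$3$3"
    if "M \<in> klein_matrices a b c d" "N \<in> klein_matrices a b c d" for M N
    using lower[OF that(1)] lower[OF that(2)] by (simp_all add: matrix_matrix_mult_def sum_3)
  show "\<psi> \<in> hom ?K Klein_four"
  proof (rule homI)
    show "\<psi> x \<in> carrier Klein_four" if "x \<in> carrier ?K" for x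
      using that \<psi>_values by (auto simp: klein_matrices_def carrier_K4)
    show "\<psi> (x \<otimes>\<^bsub>?K\<^esub> y) = \<psi> x \<otimes>\<^bsub>Klein_four\<^esub> \<psi> y" if "x \<in> carrier ?K" "y \<in> carrier ?K" for x y
      using that signs[of x] signs[of y] by (auto simp: diag_mult mult_K4 \<psi>_def)
  qed
  show "bij_betw \<psi> (carrier ?K) (carrier Klein_four)"
    unfolding bij_betw_def
    using \<psi>_values by (auto simp: klein_matrices_def carrier_K4 inj_on_def)
qed

lemma index3_other:
  fixes i j k l :: 3
  assumes "j \<noteq> i" "k \<noteq> i" "j \<noteq> k"
  shows "l = i \<or> l = j \<or> l = k"
  using assms exhaust_3[of i] exhaust_3[of j] exhaust_3[of k] exhaust_3[of l] by auto

lemma index3_third: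
  fixes i j :: 3
  obtains k where "k \<noteq> i" "k \<noteq> j"
proof -
  have "(1::3) \<noteq> 2" "(1::3) \<noteq> 3" "(2::3) \<noteq> 3" by simp_all
  then show ?thesis using that exhaust_3[of i] exhaust_3[of j] by metis
qed

locale upper_triangular_group = spectrally_unitary_group +
  assumes lower_zero: "h \<in> S \<Longrightarrow> h$2$1 = 0 \<and> h$3$1 = 0 \<and> h$3$2 = 0"
begin

lemma triangular_cases:
  assumes "h \<in> S"
  obtains t a b p q s where "h = mat3 t a b 0 p q 0 0 s"
  using lower_zero[OF assms] by (cases h rule: mat3_cases) auto

lemma diag_mult:
  assumes "h \<in> S" "k \<in> S"
  shows "(h ** k)$i$i = h$i$i * k$i$i"
proof -
  obtain t a b p q s where h: "h = mat3 t a b 0 p q 0 0 s"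
    using triangular_cases[OF assms(1)] .
  obtain t' a' b' p' q' s' where k: "k = mat3 t' a' b' 0 p' q' 0 0 s'"
    using triangular_cases[OF assms(2)] .
  show ?thesis
    using exhaust_3[of i] by (auto simp: h k)
qed

lemma diag_sign:
  assumes "h \<in> S"
  shows "h$i$i = 1 \<or> h$i$i = -1"
proof -
  obtain k where "k \<in> S" "k ** h = mat 1"
    using inverse_ex[OF assms] by blast
  then have "k$i$i * h$i$i = 1"
    using diag_mult[OF _ assms, of k i] by (simp add: mat_def)
  then show ?thesis by (auto simp: zmult_eq_1_iff)
qed

lemma ex_diag_one:
  assumes "h \<in> S"
  obtains i where "h$i$i = 1"
proof -
  obtain t a b p q s where h: "h = mat3 t a b 0 p q 0 0 s"
    using triangular_cases[OF assms] .
  have "det (h - mat 1) = (t - 1) * (p - 1) * (s - 1)"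
    by (simp add: h mat_eq_mat3 algebra_simps)
  with det_minus_one[OF assms] have "t = 1 \<or> p = 1 \<or> s = 1" by simp
  then show ?thesis using that[of 1] that[of 2] that[of 3] by (auto simp: h)
qed

lemma ex_diag1_neg: "\<exists>h\<in>S. h$1$1 = -1"
proof (rule ccontr)
  assume no_neg: "\<not> ?thesis"
  then have "h *v vec3 1 0 0 = vec3 1 0 0" if "h \<in> S" for h
    using no_neg that diag_sign[OF that, of 1] lower_zero[OF that]
    by (auto simp: matrix_vector_mult_e1)
  then show False
    using common_fixed_zero by force
qed

lemma ex_diag2_neg: "\<exists>h\<in>S. h$2$2 = -1"
proof (rule ccontr)
  assume no_neg: "\<not> ?thesis"
  then have diag2: "h$2$2 = 1" if "h \<in> S" for h
    using no_neg that diag_sign[OF that, of 2] by auto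
  obtain h0 where h0: "h0 \<in> S" "h0$1$1 = -1"
    using ex_diag1_neg by blast
  obtain t x y p z s where h0_eq: "h0 = mat3 t x y 0 p z 0 0 s"
    using triangular_cases[OF h0(1)] .
  text \<open>$(x, 2, 0)$ is fixed by $h_0$, and commuting with $h_0$ makes it fixed by all of $S$.\<close>
  have "k *v vec3 x 2 0 = vec3 x 2 0" if k: "k \<in> S" for k
  proof -
    obtain t' a b p' q s' where k_eq: "k = mat3 t' a b 0 p' q 0 0 s'"
      using triangular_cases[OF k] .
    have "t = -1" "p = 1" "p' = 1"
      using h0(2) diag2[OF h0(1)] diag2[OF k] by (simp_all add: h0_eq k_eq)
    moreover have "h0 ** k = k ** h0"
      using mult_commute h0(1) k by blast
    ultimately have "- a + x = t' * x + a"
      by (simp add: h0_eq k_eq)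
    then show ?thesis
      using \<open>p' = 1\<close> by (simp add: k_eq)
  qed
  then have "vec3 x 2 0 = (0::int^3)"
    by (rule common_fixed_zero)
  then show False by simp
qed

lemma ex_diag12_neg: "\<exists>h\<in>S. h$1$1 = -1 \<and> h$2$2 = -1"
proof -
  obtain h1 where h1: "h1 \<in> S" "h1$1$1 = -1" using ex_diag1_neg by blast
  obtain h2 where h2: "h2 \<in> S" "h2$2$2 = -1" using ex_diag2_neg by blast
  consider "h1$2$2 = -1" | "h2$1$1 = -1" | "h1$2$2 = 1" "h2$1$1 = 1"
    using diag_sign h1(1) h2(1) by blast
  then show ?thesis
  proof cases
    case 3
    then have "(h1 ** h2)$1$1 = -1" "(h1 ** h2)$2$2 = -1"
      using h1 h2 by (simp_all add: diag_mult)
    with mult_mem[OF h1(1) h2(1)] show ?thesis by blast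
  qed (use h1 h2 in blast)+
qed

lemma ex_diag3_neg: "\<exists>h\<in>S. h$3$3 = -1"
proof (rule ccontr)
  assume no_neg: "\<not> ?thesis"
  then have diag3: "h$3$3 = 1" if "h \<in> S" for h
    using no_neg that diag_sign[OF that, of 3] by auto
  obtain h0 where h0: "h0 \<in> S" "h0$1$1 = -1" "h0$2$2 = -1"
    using ex_diag12_neg by blast
  obtain t x y p z s where h0_eq: "h0 = mat3 t x y 0 p z 0 0 s"
    using triangular_cases[OF h0(1)] .
  have tps: "t = -1" "p = -1" "s = 1"
    using h0 diag3[OF h0(1)] by (simp_all add: h0_eq)
  text \<open>$(xz + 2y, 2z, 4)$ is fixed by $h_0$, and commuting with $h_0$ makes it fixed by all of $S$.\<close>
  have "k *v vec3 (x * z + 2 * y) (2 * z) 4 = vec3 (x * z + 2 * y) (2 * z) 4" if k: "k \<in> S" for k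
  proof -
    obtain t' a b p' q s' where k_eq: "k = mat3 t' a b 0 p' q 0 0 s'"
      using triangular_cases[OF k] .
    have "s' = 1"
      using diag3[OF k] by (simp add: k_eq)
    have "h0 ** k = k ** h0"
      using mult_commute h0(1) k by blast
    then have E: "- a + x * p' = t' * x - a" "- b + x * q + y = t' * y + a * z + b" "- q + z = p' * z + q"
      by (simp_all add: h0_eq k_eq tps \<open>s' = 1\<close> algebra_simps)
    have "t' * (x * z + 2 * y) + a * (2 * z) + b * 4 = x * z + 2 * y" "p' * (2 * z) + q * 4 = 2 * z"
      using E by algebra+
    then show ?thesis
      by (simp add: k_eq \<open>s' = 1\<close> algebra_simps)
  qed
  then have "vec3 (x * z + 2 * y) (2 * z) 4 = (0::int^3)"
    by (rule common_fixed_zero)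
  then show False by simp
qed

lemma ex_diag_neg: "\<exists>h\<in>S. h$i$i = -1"
  using exhaust_3[of i] ex_diag1_neg ex_diag2_neg ex_diag3_neg by blast

lemma diag_not_single_neg:
  assumes "h \<in> S" "h$i$i = -1" "h$j$j = 1" "h$k$k = 1" "j \<noteq> i" "k \<noteq> i" "j \<noteq> k"
  shows False
proof -
  have all_neg_False: False if g: "g \<in> S" "g$i$i = -1" "g$j$j = -1" "g$k$k = -1" for g
  proof -
    obtain l where "g$l$l = 1" using ex_diag_one[OF g(1)] .
    with g index3_other[OF assms(5-7), of l] show False by auto
  qed
  have not_both: "\<not> (g$j$j = -1 \<and> g$k$k = -1)" if gS: "g \<in> S" for g
  proof
    assume g: "g$j$j = -1 \<and> g$k$k = -1"
    consider "g$i$i = -1" | "g$i$i = 1" using diag_sign[OF gS] by blast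
    then show False
    proof cases
      case 1
      with gS g show False by (intro all_neg_False) auto
    next
      case 2
      with assms(1-4) gS g show False
        by (intro all_neg_False[of "h ** g"]) (simp_all add: diag_mult mult_mem)
    qed
  qed
  obtain a where a: "a \<in> S" "a$j$j = -1" using ex_diag_neg by blast
  obtain b where b: "b \<in> S" "b$k$k = -1" using ex_diag_neg by blast
  have "a$k$k = 1" "b$j$j = 1"
    using not_both[OF a(1)] not_both[OF b(1)] diag_sign a b by blast+
  with a b have "(a ** b)$j$j = -1" "(a ** b)$k$k = -1"
    by (simp_all add: diag_mult)
  with not_both[OF mult_mem[OF a(1) b(1)]] show False by blast
qed

lemma ex_diag_pair_neg:
  assumes "i \<noteq> j"
  obtains h where "h \<in> S" "h$i$i = -1" "h$j$j = -1"
proof -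
  obtain k where k: "k \<noteq> i" "k \<noteq> j"
    by (rule index3_third)
  obtain a where a: "a \<in> S" "a$i$i = -1" using ex_diag_neg by blast
  obtain b where b: "b \<in> S" "b$j$j = -1" using ex_diag_neg by blast
  consider "a$j$j = -1" | "b$i$i = -1" | "a$j$j = 1" "b$i$i = 1"
    using diag_sign a(1) b(1) by blast
  then show ?thesis
  proof cases
    case 3
    have "a$k$k = -1"
      using diag_not_single_neg[OF a(1,2) 3(1), of k] diag_sign[OF a(1), of k] assms k by auto
    have "b$k$k = -1"
      using diag_not_single_neg[OF b(1,2) 3(2), of k] diag_sign[OF b(1), of k] assms k by auto
    show ?thesis
      using a b 3 mult_mem[OF a(1) b(1)] by (intro that[of "a ** b"]) (simp_all add: diag_mult)
  qed (use a b that in blast)+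
qed

lemma diag_not_all_neg:
  assumes "h \<in> S" "h$1$1 = -1" "h$2$2 = -1" "h$3$3 = -1"
  shows False
proof -
  obtain i where "h$i$i = 1" using ex_diag_one[OF assms(1)] .
  with assms(2-4) show False using exhaust_3[of i] by auto
qed

lemma ex_klein_generators:
  obtains a b e x c d where
    "mat3 1 a b 0 (-1) e 0 0 (-1) \<in> S" "mat3 (-1) x c 0 (-1) d 0 0 1 \<in> S"
proof -
  obtain \<alpha> where \<alpha>: "\<alpha> \<in> S" "\<alpha>$2$2 = -1" "\<alpha>$3$3 = -1"
    using ex_diag_pair_neg[of 2 3] by auto
  then have "\<alpha>$1$1 = 1"
    using diag_sign[OF \<alpha>(1), of 1] diag_not_all_neg by blast
  obtain \<beta> where \<beta>: "\<beta> \<in> S" "\<beta>$1$1 = -1" "\<beta>$2$2 = -1"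
    using ex_diag_pair_neg[of 1 2] by auto
  then have "\<beta>$3$3 = 1"
    using diag_sign[OF \<beta>(1), of 3] diag_not_all_neg by blast
  obtain t a b p e s where \<alpha>_eq: "\<alpha> = mat3 t a b 0 p e 0 0 s"
    using triangular_cases[OF \<alpha>(1)] .
  obtain t' x c p' d s' where \<beta>_eq: "\<beta> = mat3 t' x c 0 p' d 0 0 s'"
    using triangular_cases[OF \<beta>(1)] .
  show ?thesis
    using that[of a b e x c d] \<alpha> \<beta> \<open>\<alpha>$1$1 = 1\<close> \<open>\<beta>$3$3 = 1\<close> by (simp add: \<alpha>_eq \<beta>_eq)
qed

lemma unipotent_eq_one:
  assumes "h \<in> S" "h$1$1 = 1" "h$2$2 = 1" "h$3$3 = 1"
  shows "h = mat 1"
proof -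
  obtain a b e x c d where
    \<alpha>: "mat3 1 a b 0 (-1) e 0 0 (-1) \<in> S" and \<beta>: "mat3 (-1) x c 0 (-1) d 0 0 1 \<in> S"
    by (rule ex_klein_generators) (rule that)
  obtain t p q u r s where h: "h = mat3 t p q 0 u r 0 0 s"
    using triangular_cases[OF assms(1)] .
  have tus: "t = 1" "u = 1" "s = 1"
    using assms(2-4) by (simp_all add: h)
  have "h ** mat3 1 a b 0 (-1) e 0 0 (-1) = mat3 1 a b 0 (-1) e 0 0 (-1) ** h"
    using mult_commute[OF assms(1) \<alpha>] .
  then have E1: "p = 0" "a * r + 2 * q = 0"
    by (auto simp: h tus algebra_simps)
  have "h ** mat3 (-1) x c 0 (-1) d 0 0 1 = mat3 (-1) x c 0 (-1) d 0 0 1 ** h"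
    using mult_commute[OF assms(1) \<beta>] .
  then have "r = 0"
    by (simp add: h tus algebra_simps)
  with E1 show ?thesis by (simp add: h tus mat_eq_mat3)
qed

lemma square_eq_one:
  assumes "h \<in> S"
  shows "h ** h = mat 1"
proof (rule unipotent_eq_one)
  show "h ** h \<in> S" using mult_mem[OF assms assms] .
  show "(h ** h)$1$1 = 1" "(h ** h)$2$2 = 1" "(h ** h)$3$3 = 1"
    using diag_sign[OF assms, of 1] diag_sign[OF assms, of 2] diag_sign[OF assms, of 3]
    by (auto simp: diag_mult[OF assms assms])
qed

lemma diag_inj:
  assumes "h \<in> S" "k \<in> S" "h$1$1 = k$1$1" "h$2$2 = k$2$2" "h$3$3 = k$3$3"
  shows "h = k"
proof -
  have "h ** k = mat 1"
  proof (rule unipotent_eq_one)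
    show "h ** k \<in> S" using mult_mem[OF assms(1,2)] .
    show "(h ** k)$1$1 = 1" "(h ** k)$2$2 = 1" "(h ** k)$3$3 = 1"
      using diag_sign[OF assms(2), of 1] diag_sign[OF assms(2), of 2] diag_sign[OF assms(2), of 3]
        assms(3-5)
      by (auto simp: diag_mult[OF assms(1,2)])
  qed
  then have "h ** (k ** k) = k"
    by (metis matrix_mul_assoc matrix_mul_lid)
  with square_eq_one[OF assms(2)] show ?thesis by simp
qed

lemma diag_cases:
  assumes "h \<in> S"
  obtains "h$1$1 = 1" "h$2$2 = 1" "h$3$3 = 1"
    | "h$1$1 = 1" "h$2$2 = -1" "h$3$3 = -1"
    | "h$1$1 = -1" "h$2$2 = -1" "h$3$3 = 1"
    | "h$1$1 = -1" "h$2$2 = 1" "h$3$3 = -1"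
proof -
  have "(1::3) \<noteq> 2" "(1::3) \<noteq> 3" "(2::3) \<noteq> 3" by simp_all
  then have "\<not> (h$1$1 = -1 \<and> h$2$2 = 1 \<and> h$3$3 = 1)" "\<not> (h$2$2 = -1 \<and> h$1$1 = 1 \<and> h$3$3 = 1)"
    "\<not> (h$3$3 = -1 \<and> h$1$1 = 1 \<and> h$2$2 = 1)"
    using diag_not_single_neg[OF assms] by metis+
  with that diag_sign[OF assms] diag_not_all_neg[OF assms] show ?thesis by metis
qed

lemma upper_triangular_klein:
  obtains a b c d where "a * d + 2 * (b + c) = 0" "S = klein_matrices a b c d"
proof -
  obtain a b e x c d where
    \<alpha>: "mat3 1 a b 0 (-1) e 0 0 (-1) \<in> S" and \<beta>: "mat3 (-1) x c 0 (-1) d 0 0 1 \<in> S"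
    by (rule ex_klein_generators) (rule that)
  have "e = 0"
    using square_eq_one[OF \<alpha>] by (simp add: mat_eq_mat3)
  have "x = 0"
    using square_eq_one[OF \<beta>] by (simp add: mat_eq_mat3)
  have gens: "klein_gen1 a b \<in> S" "klein_gen2 c d \<in> S"
    using \<alpha> \<beta> by (simp_all add: klein_gen1_def klein_gen2_def \<open>e = 0\<close> \<open>x = 0\<close>)
  then have "klein_gen1 a b ** klein_gen2 c d = klein_gen2 c d ** klein_gen1 a b"
    by (rule mult_commute)
  then have rel: "a * d + 2 * (b + c) = 0"
    by (simp add: klein_gen1_def klein_gen2_def algebra_simps)
  have prod: "klein_gen1 a b ** klein_gen2 c d \<in> S"
    using mult_mem[OF gens] .
  have "S \<subseteq> klein_matrices a b c d"
  proof
    fix h assume h: "h \<in> S"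
    from h show "h \<in> klein_matrices a b c d"
    proof (cases rule: diag_cases)
      case 1
      then have "h = mat 1" using unipotent_eq_one[OF h] by simp
      then show ?thesis by (simp add: klein_matrices_def)
    next
      case 2
      then have "h = klein_gen1 a b" using diag_inj[OF h gens(1)] by (simp add: klein_gen1_def)
      then show ?thesis by (simp add: klein_matrices_def)
    next
      case 3
      then have "h = klein_gen2 c d" using diag_inj[OF h gens(2)] by (simp add: klein_gen2_def)
      then show ?thesis by (simp add: klein_matrices_def)
    next
      case 4
      then have "h = klein_gen1 a b ** klein_gen2 c d"
        using diag_inj[OF h prod] by (simp add: klein_gen1_def klein_gen2_def)
      then show ?thesis by (simp add: klein_matrices_def)
    qed
  qed
  moreover have "klein_matrices a b c d \<subseteq> S"
    using one_mem gens prod by (simp add: klein_matrices_def)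
  ultimately have "S = klein_matrices a b c d" by (rule subset_antisym)
  with rel show ?thesis by (rule that)
qed

end

lemma (in spectrally_unitary_group) conj_klein:
  obtains H Hinv :: "int^3^3" and a b c d where "H ** Hinv = mat 1" "Hinv ** H = mat 1"
    "a * d + 2 * (b + c) = 0" "(\<lambda>h. H ** h ** Hinv) ` S = klein_matrices a b c d"
proof -
  obtain H1 Hinv1 :: "int^3^3" where H1: "H1 ** Hinv1 = mat 1" "Hinv1 ** H1 = mat 1"
    "\<And>h. h \<in> S \<Longrightarrow> (H1 ** h ** Hinv1)$2$1 = 0 \<and> (H1 ** h ** Hinv1)$3$1 = 0"
    by (rule conj_first_column_zero) (rule that)
  define S1 where "S1 = (\<lambda>h. H1 ** h ** Hinv1) ` S"
  interpret S1: block_triangular_group S1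
  proof (rule block_triangular_group.intro)
    show "spectrally_unitary_group S1"
      unfolding S1_def using spectrally_unitary_group_axioms H1(1,2) by (rule spectrally_unitary_group_conj)
    show "block_triangular_group_axioms S1"
      by (rule block_triangular_group_axioms.intro) (use H1(3) in \<open>auto simp: S1_def\<close>)
  qed
  obtain H2 Hinv2 :: "int^3^3" where H2: "H2 ** Hinv2 = mat 1" "Hinv2 ** H2 = mat 1"
    "\<And>h. h \<in> S1 \<Longrightarrow>
       (H2 ** h ** Hinv2)$2$1 = 0 \<and> (H2 ** h ** Hinv2)$3$1 = 0 \<and> (H2 ** h ** Hinv2)$3$2 = 0"
    by (rule S1.conj_lower_triangular) (rule that)
  define S2 where "S2 = (\<lambda>h. H2 ** h ** Hinv2) ` S1"
  interpret S2: upper_triangular_group S2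
  proof (rule upper_triangular_group.intro)
    show "spectrally_unitary_group S2"
      unfolding S2_def using S1.spectrally_unitary_group_axioms H2(1,2)
      by (rule spectrally_unitary_group_conj)
    show "upper_triangular_group_axioms S2"
      by (rule upper_triangular_group_axioms.intro) (use H2(3) in \<open>auto simp: S2_def\<close>)
  qed
  obtain a b c d where "a * d + 2 * (b + c) = 0" "S2 = klein_matrices a b c d"
    by (rule S2.upper_triangular_klein) (rule that)
  moreover have "(H2 ** H1) ** (Hinv1 ** Hinv2) = H2 ** (H1 ** Hinv1) ** Hinv2"
    "(Hinv1 ** Hinv2) ** (H2 ** H1) = Hinv1 ** (Hinv2 ** H2) ** H1"
    by (simp_all add: matrix_mul_assoc)
  then have "(H2 ** H1) ** (Hinv1 ** Hinv2) = mat 1" "(Hinv1 ** Hinv2) ** (H2 ** H1) = mat 1"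
    using H1(1,2) H2(1,2) by simp_all
  ultimately show ?thesis
    using that unfolding S2_def S1_def conj_conj_image by blast
qed

section \<open>Bases of $\mathbb{Z}^p$\<close>

definition lincomb :: "('p \<Rightarrow> int^'p) \<Rightarrow> int^'p \<Rightarrow> int^'p" where
  "lincomb w c = (\<Sum>i\<in>UNIV. c $ i *s w i)"

lemma Zbasis_iff_bij_lincomb: "Zbasis w \<longleftrightarrow> bij (lincomb w)"
  by (simp add: Zbasis_def lincomb_def[abs_def])

lemma lincomb_add: "lincomb w (c + d) = lincomb w c + lincomb w d"
  by (simp add: lincomb_def vector_sadd_rdistrib sum.distrib)

lemma lincomb_scale_axis: "lincomb w (t *s axis j 1) = t *s w j"
proof -
  have "lincomb w (t *s axis j 1) = (\<Sum>i\<in>UNIV. if i = j then t *s w j else 0)"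
    unfolding lincomb_def by (rule sum.cong) (auto simp: axis_def)
  then show ?thesis by simp
qed

lemma Zbasis_axis: "Zbasis (\<lambda>i::'p::finite. axis i (1::int))"
proof -
  have "lincomb (\<lambda>i::'p. axis i (1::int)) = id"
    by (simp add: fun_eq_iff lincomb_def basis_expansion)
  then show ?thesis by (simp add: Zbasis_iff_bij_lincomb)
qed

lemma Zbasis_add_multiples:
  assumes "Zbasis w" "a j = 0"
  shows "Zbasis (\<lambda>k. w k + a k *s w j)"
proof -
  define s where "s c = (\<Sum>k\<in>UNIV. c $ k * a k)" for c :: "int^'a"
  have s_add: "s (c + d) = s c + s d" for c d
    by (simp add: s_def algebra_simps sum.distrib)
  have "s (t *s axis j 1) = (\<Sum>k\<in>UNIV. if k = j then t * a j else 0)" for t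
    unfolding s_def by (rule sum.cong) (auto simp: axis_def)
  then have s_shift: "s (c + t *s axis j 1) = s c" for c t
    using assms(2) by (simp add: s_add)
  define T where "T c = c + s c *s axis j 1" for c
  have "lincomb (\<lambda>k. w k + a k *s w j) = lincomb w \<circ> T"
  proof
    fix c
    have "lincomb (\<lambda>k. w k + a k *s w j) c = lincomb w c + s c *s w j"
      by (simp add: lincomb_def s_def vector_add_ldistrib sum.distrib vector_smult_assoc
          vec_eq_iff sum_distrib_right)
    then show "lincomb (\<lambda>k. w k + a k *s w j) c = (lincomb w \<circ> T) c"
      by (simp add: T_def lincomb_add lincomb_scale_axis)
  qed
  moreover have "bij T"
  proof (rule bij_betw_byWitness[of UNIV "\<lambda>c. c - s c *s axis j 1"])
    have s_unshift: "s (c - s c *s axis j 1) = s c" for c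
      using s_shift[of "c - s c *s axis j 1" "s c"] by simp
    show "\<forall>c\<in>UNIV. T c - s (T c) *s axis j 1 = c"
      by (simp add: T_def s_shift)
    show "\<forall>c\<in>UNIV. T (c - s c *s axis j 1) = c"
      by (simp add: T_def s_unshift)
  qed auto
  ultimately show ?thesis
    using assms(1) by (simp add: Zbasis_iff_bij_lincomb bij_comp)
qed

lemma Zbasis_add_multiples2:
  assumes "Zbasis w" "a i = 0" "a j = 0" "b j = 0"
  shows "Zbasis (\<lambda>k. w k + a k *s w i + b k *s w j)"
proof -
  let ?w1 = "\<lambda>k. w k + a k *s w i"
  have "Zbasis ?w1"
    using assms(1,2) by (rule Zbasis_add_multiples)
  then have "Zbasis (\<lambda>k. ?w1 k + b k *s ?w1 j)"
    using assms(4) by (rule Zbasis_add_multiples)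
  then show ?thesis
    using assms(3) by simp
qed

lemma Zbasis_add:
  assumes "Zbasis w" "i \<noteq> j"
  shows "Zbasis (w(i := w i + w j))"
proof -
  have "Zbasis (\<lambda>k. w k + (if k = i then 1 else 0) *s w j)"
    using assms by (intro Zbasis_add_multiples) auto
  moreover have "(\<lambda>k. w k + (if k = i then 1 else 0) *s w j) = w(i := w i + w j)"
    by (auto simp: fun_eq_iff)
  ultimately show ?thesis by simp
qed

section \<open>Actions of $\mathbb{Z}^p$ by matrices\<close>

locale matrix_action =
  fixes A :: "int^'p \<Rightarrow> 'a::comm_ring_1^'n^'n"
  assumes map_add: "A (l + m) = A l ** A m"
    and map_zero: "A 0 = mat 1"
begin

lemma map_commute: "A l ** A m = A m ** A l"
  by (metis add.commute map_add)

lemma range_mult_mem: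
  assumes "X \<in> range A" "Y \<in> range A"
  shows "X ** Y \<in> range A"
proof -
  obtain l m where "X = A l" "Y = A m"
    using assms by blast
  then show ?thesis by (metis map_add rangeI)
qed

lemma map_uminus: "A (- l) ** A l = mat 1"
  by (metis add.left_inverse map_add map_zero)

lemma map_sum_mem:
  assumes "finite F" "mat 1 \<in> G" "\<And>X Y. X \<in> G \<Longrightarrow> Y \<in> G \<Longrightarrow> X ** Y \<in> G"
    and "\<And>i. i \<in> F \<Longrightarrow> A (f i) \<in> G"
  shows "A (sum f F) \<in> G"
  using assms(1,4) by (induction F rule: finite_induct) (simp_all add: map_zero map_add assms(2,3))

lemma map_scale_mem:
  assumes "A x ** A x = mat 1"
  shows "A (c *s x) \<in> {mat 1, A x}"
proof -
  have nat: "A (of_nat n *s x) \<in> {mat 1, A x}" for n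
  proof (induction n)
    case 0
    then show ?case by (simp add: map_zero)
  next
    case (Suc n)
    have "A (of_nat (Suc n) *s x) = A (of_nat n *s x) ** A x"
      by (simp add: vector_sadd_rdistrib add.commute flip: map_add)
    with Suc assms show ?case by auto
  qed
  show ?thesis
  proof (cases "c \<ge> 0")
    case True
    then show ?thesis using nat[of "nat c"] by simp
  next
    case False
    define y where "y = of_nat (nat (- c)) *s x"
    have cy: "c *s x = - y"
      using False by (simp add: y_def vec_eq_iff)
    have inv: "A (- y) ** A y = mat 1"
      by (rule map_uminus)
    from nat[of "nat (- c)"] have "A y = mat 1 \<or> A y = A x"
      by (simp add: y_def)
    then have "A (- y) \<in> {mat 1, A x}"
    proof
      assume "A y = mat 1"
      with inv show ?thesis by simp
    next
      assume "A y = A x"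
      have "A (- y) = A (- y) ** (A x ** A x)"
        using assms by simp
      also have "\<dots> = (A (- y) ** A y) ** A x"
        using \<open>A y = A x\<close> by (simp add: matrix_mul_assoc)
      also have "\<dots> = A x"
        using inv by simp
      finally show ?thesis by simp
    qed
    with cy show ?thesis by simp
  qed
qed

lemma range_subset_of_axes:
  assumes "\<tau> ** \<tau> = mat 1" "\<And>i. A (axis i 1) \<in> {mat 1, \<tau>}"
  shows "A l \<in> {mat 1, \<tau>}"
proof -
  have "A (l $ i *s axis i 1) \<in> {mat 1, \<tau>}" for i
  proof -
    have "A (axis i 1) ** A (axis i 1) = mat 1"
      using assms(1) assms(2)[of i] by auto
    then show ?thesis
      using map_scale_mem[of "axis i 1" "l $ i"] assms(2)[of i] by auto
  qed
  then have "A (\<Sum>i\<in>UNIV. l $ i *s axis i 1) \<in> {mat 1, \<tau>}"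
    using assms(1) by (intro map_sum_mem) auto
  then show ?thesis by (simp add: basis_expansion)
qed

lemma map_lincomb_eq_one:
  assumes "\<And>i. c $ i \<noteq> 0 \<Longrightarrow> A (w i) = mat 1"
  shows "A (lincomb w c) = mat 1"
proof -
  have "A (c $ i *s w i) \<in> {mat 1}" for i
    using map_scale_mem[of "w i" "c $ i"] assms[of i] by (cases "c $ i = 0") (auto simp: map_zero)
  then have "A (\<Sum>i\<in>UNIV. c $ i *s w i) \<in> {mat 1}"
    by (intro map_sum_mem) auto
  then show ?thesis by (simp add: lincomb_def)
qed

end

locale klein_matrix_action = matrix_action +
  fixes g1 g2
  assumes range_eq: "range A = {mat 1, g1, g2, g1 ** g2}"
    and range_square: "X \<in> range A \<Longrightarrow> X ** X = mat 1"
    and g1_neq_one: "g1 \<noteq> mat 1" and g2_neq_one: "g2 \<noteq> mat 1" and g1_neq_g2: "g1 \<noteq> g2"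
begin

lemma range_cancel:
  assumes "X \<in> range A" "Y \<in> range A"
  shows "X ** (X ** Y) = Y" "(X ** Y) ** Y = X" "Y ** (X ** Y) = X" "(X ** Y) ** X = Y"
proof -
  have comm: "X ** Y = Y ** X"
    using assms map_commute by auto
  have sq: "X ** X = mat 1" "Y ** Y = mat 1"
    using assms range_square by auto
  have left: "V ** (V ** U) = U" if "V ** V = mat 1" for U V
    using that by (simp add: matrix_mul_assoc)
  have right: "(U ** V) ** V = U" if "V ** V = mat 1" for U V
    using that by (simp flip: matrix_mul_assoc)
  show "X ** (X ** Y) = Y" "(X ** Y) ** Y = X"
    using sq by (simp_all add: left right)
  show "Y ** (X ** Y) = X" "(X ** Y) ** X = Y"
    using sq by (simp_all add: comm left right)
qed

lemma card_generated:
  assumes "X \<in> range A" "Y \<in> range A" "X \<noteq> mat 1" "Y \<noteq> mat 1" "X \<noteq> Y"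
  shows "card {mat 1, X, Y, X ** Y} = 4"
proof -
  note c = range_cancel[OF assms(1,2)]
  have sq: "X ** X = mat 1" "Y ** Y = mat 1"
    using assms(1,2) range_square by auto
  have "X ** Y \<noteq> mat 1" "X ** Y \<noteq> X" "X ** Y \<noteq> Y"
    using c(1) assms(5) apply auto[1]
    using c(1) sq(1) assms(4) apply auto[1]
    using c(2) sq(2) assms(3) by auto
  with assms(3-5) show ?thesis by simp
qed

lemma range_eq_generated:
  assumes "X \<in> range A" "Y \<in> range A" "X \<noteq> mat 1" "Y \<noteq> mat 1" "X \<noteq> Y"
  shows "range A = {mat 1, X, Y, X ** Y}"
proof (rule sym, rule card_subset_eq)
  have "g1 \<in> range A" "g2 \<in> range A"
    using range_eq by auto
  then have "card (range A) = 4"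
    using card_generated g1_neq_one g2_neq_one g1_neq_g2 by (simp add: range_eq)
  then show "card {mat 1, X, Y, X ** Y} = card (range A)"
    using card_generated[OF assms] by simp
  show "finite (range A)"
    using range_eq by simp
  have "mat 1 \<in> range A"
    by (metis map_zero rangeI)
  then show "{mat 1, X, Y, X ** Y} \<subseteq> range A"
    by (simp add: assms(1,2) range_mult_mem)
qed

lemma generating_axes:
  obtains i1 i2 where "i1 \<noteq> i2" "A (axis i1 1) \<noteq> mat 1" "A (axis i2 1) \<noteq> mat 1"
    "A (axis i1 1) \<noteq> A (axis i2 1)"
proof -
  have "g1 \<in> range A" "g2 \<in> range A"
    using range_eq by auto
  then obtain l1 l2 where g: "g1 = A l1" "g2 = A l2"
    by blast
  obtain i1 where i1: "A (axis i1 1) \<noteq> mat 1"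
  proof (rule ccontr)
    assume "\<not> thesis"
    then have ax: "A (axis i 1) \<in> {mat 1, mat 1}" for i
      using that by auto
    have "A l1 \<in> {mat 1, mat 1}"
      by (rule range_subset_of_axes[OF _ ax]) simp
    then show False
      using g(1) g1_neq_one by simp
  qed
  obtain i2 where i2: "A (axis i2 1) \<notin> {mat 1, A (axis i1 1)}"
  proof (rule ccontr)
    assume "\<not> thesis"
    then have "A (axis i 1) \<in> {mat 1, A (axis i1 1)}" for i
      using that by auto
    moreover have "A (axis i1 1) ** A (axis i1 1) = mat 1"
      by (simp add: range_square)
    ultimately have "A l \<in> {mat 1, A (axis i1 1)}" for l
      using range_subset_of_axes by blast
    then have "g1 = A (axis i1 1)" "g2 = A (axis i1 1)"
      using g g1_neq_one g2_neq_one by auto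
    then show False
      using g1_neq_g2 by simp
  qed
  from i1 i2 show ?thesis
    by (intro that[of i1 i2]) auto
qed

lemma adapted_basis_pair:
  obtains w i1 i2 where "i1 \<noteq> i2" "Zbasis w" "A (w i1) = g1" "A (w i2) = g2"
proof -
  obtain i1 i2 where i: "i1 \<noteq> i2" "A (axis i1 1) \<noteq> mat 1" "A (axis i2 1) \<noteq> mat 1"
    "A (axis i1 1) \<noteq> A (axis i2 1)"
    by (rule generating_axes)
  define X Y where "X = A (axis i1 1)" and "Y = A (axis i2 1)"
  have XY: "X \<in> range A" "Y \<in> range A"
    by (simp_all add: X_def Y_def)
  note c = range_cancel[OF XY]
  define R where "R U V \<longleftrightarrow> (\<exists>w. Zbasis w \<and> A (w i1) = U \<and> A (w i2) = V)" for U V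
  text \<open>The moves $(U, V) \mapsto (UV, V)$ and $(U, V) \mapsto (U, VU)$ run through all six ordered
    generating pairs of the Klein group.\<close>
  have move1: "R (U ** V) V" if UV: "R U V" for U V
  proof -
    obtain w where w: "Zbasis w" "A (w i1) = U" "A (w i2) = V"
      using UV by (auto simp: R_def)
    have "Zbasis (w(i1 := w i1 + w i2))"
      using w(1) i(1) by (rule Zbasis_add)
    with w i(1) show ?thesis
      unfolding R_def by (intro exI[of _ "w(i1 := w i1 + w i2)"]) (simp add: map_add)
  qed
  have move2: "R U (V ** U)" if UV: "R U V" for U V
  proof -
    obtain w where w: "Zbasis w" "A (w i1) = U" "A (w i2) = V"
      using UV by (auto simp: R_def)
    have "Zbasis (w(i2 := w i2 + w i1))"
      using w(1) i(1) by (intro Zbasis_add) auto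
    with w i(1) show ?thesis
      unfolding R_def by (intro exI[of _ "w(i2 := w i2 + w i1)"]) (simp add: map_add)
  qed
  have R0: "R X Y"
    unfolding R_def X_def Y_def using Zbasis_axis by blast
  have R1: "R (X ** Y) Y" using move1[OF R0] .
  have R2: "R (X ** Y) X" using move2[OF R1] c(3) by simp
  have R3: "R Y X" using move1[OF R2] c(4) by simp
  have R4: "R Y (X ** Y)" using move2[OF R3] .
  have R5: "R X (X ** Y)" using move1[OF R4] c(3) by simp
  have "{mat 1, g1, g2, g1 ** g2} = {mat 1, X, Y, X ** Y}"
    using range_eq range_eq_generated[OF XY] i(2-4) by (simp add: X_def Y_def)
  then have "g1 \<in> {X, Y, X ** Y}" "g2 \<in> {X, Y, X ** Y}"
    using g1_neq_one g2_neq_one by blast+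
  with g1_neq_g2 R0 R1 R2 R3 R4 R5 have "R g1 g2"
    by auto
  with i(1) show ?thesis
    unfolding R_def using that by blast
qed

lemma adapted_basis:
  obtains w i1 i2 where "i1 \<noteq> i2" "Zbasis w" "A (w i1) = g1" "A (w i2) = g2"
    "\<And>k. k \<noteq> i1 \<Longrightarrow> k \<noteq> i2 \<Longrightarrow> A (w k) = mat 1"
proof -
  obtain w i1 i2 where w: "i1 \<noteq> i2" "Zbasis w" "A (w i1) = g1" "A (w i2) = g2"
    by (rule adapted_basis_pair)
  have g: "g1 \<in> range A" "g2 \<in> range A"
    using range_eq by auto
  have sq: "g1 ** g1 = mat 1" "g2 ** g2 = mat 1"
    using g range_square by auto
  have "\<exists>\<alpha> \<beta>. A (w k) ** A (\<alpha> *s w i1) ** A (\<beta> *s w i2) = mat 1" for k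
  proof -
    have "A (w k) \<in> {mat 1, g1, g2, g1 ** g2}"
      using range_eq by blast
    then consider "A (w k) = mat 1" | "A (w k) = g1" | "A (w k) = g2" | "A (w k) = g1 ** g2"
      by blast
    then show ?thesis
    proof cases
      case 1
      then show ?thesis by (intro exI[of _ 0]) (simp add: map_zero)
    next
      case 2
      then show ?thesis by (intro exI[of _ 1] exI[of _ 0]) (simp add: map_zero w(3) sq)
    next
      case 3
      then show ?thesis by (intro exI[of _ 0] exI[of _ 1]) (simp add: map_zero w(4) sq)
    next
      case 4
      then show ?thesis
        by (intro exI[of _ 1]) (simp add: w(3,4) sq range_cancel(4)[OF g])
    qed
  qed
  then obtain \<alpha> \<beta> where \<alpha>\<beta>: "\<And>k. A (w k) ** A (\<alpha> k *s w i1) ** A (\<beta> k *s w i2) = mat 1"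
    by metis
  define a where "a k = (if k = i1 \<or> k = i2 then 0 else \<alpha> k)" for k
  define b where "b k = (if k = i1 \<or> k = i2 then 0 else \<beta> k)" for k
  define w' where "w' k = w k + a k *s w i1 + b k *s w i2" for k
  have "Zbasis w'"
    unfolding w'_def using w(2) by (rule Zbasis_add_multiples2) (simp_all add: a_def b_def)
  moreover have "w' i1 = w i1" "w' i2 = w i2"
    by (simp_all add: w'_def a_def b_def)
  moreover have "A (w' k) = mat 1" if "k \<noteq> i1" "k \<noteq> i2" for k
    using \<alpha>\<beta>[of k] that by (simp add: w'_def a_def b_def map_add)
  ultimately show ?thesis
    using w(1,3,4) by (intro that[of i1 i2 w']) auto
qed

end

lemma klein_matrix_action_conj:
  fixes A :: "int^'p \<Rightarrow> int^3^3"
  assumes "matrix_action A" "H ** Hinv = mat 1" "Hinv ** H = mat 1" "a * d + 2 * (b + c) = 0"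
    and K: "(\<lambda>h. H ** h ** Hinv) ` range A = klein_matrices a b c d"
  shows "klein_matrix_action A (Hinv ** klein_gen1 a b ** H) (Hinv ** klein_gen2 c d ** H)"
proof -
  let ?d = "\<lambda>h. Hinv ** h ** H"
  have range_A: "range A = ?d ` klein_matrices a b c d"
    unfolding K[symmetric] image_image by (simp add: conj_cancel[OF assms(3)])
  have d_inj: "?d M = ?d N \<Longrightarrow> M = N" for M N
    by (metis conj_cancel[OF assms(2)])
  show ?thesis
  proof (rule klein_matrix_action.intro[OF assms(1)], rule klein_matrix_action_axioms.intro)
    show "range A = {mat 1, ?d (klein_gen1 a b), ?d (klein_gen2 c d), ?d (klein_gen1 a b) ** ?d (klein_gen2 c d)}"
      using assms(3) by (simp add: range_A klein_matrices_def conj_mult[OF assms(2)])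
    show "X ** X = mat 1" if "X \<in> range A" for X
      using that assms(3,4) klein_matrices_square by (auto simp: range_A conj_mult[OF assms(2)])
    show "?d (klein_gen1 a b) \<noteq> mat 1" "?d (klein_gen2 c d) \<noteq> mat 1"
      "?d (klein_gen1 a b) \<noteq> ?d (klein_gen2 c d)"
    proof -
      have "klein_gen1 a b \<noteq> mat 1" "klein_gen2 c d \<noteq> mat 1" "klein_gen1 a b \<noteq> klein_gen2 c d"
        by (simp_all add: klein_gen1_def klein_gen2_def mat_eq_mat3)
      moreover have "?d (mat 1) = mat 1"
        using assms(3) by simp
      ultimately show "?d (klein_gen1 a b) \<noteq> mat 1" "?d (klein_gen2 c d) \<noteq> mat 1"
        "?d (klein_gen1 a b) \<noteq> ?d (klein_gen2 c d)"
        using d_inj by metis+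
    qed
  qed
qed

lemma Zaction_zero:
  assumes "Zaction A"
  shows "A 0 = mat 1"
proof -
  obtain N where N: "N ** A 0 = mat 1"
    using assms unfolding Zaction_def int_invertible_def by blast
  have "A 0 = A 0 ** A 0"
    using assms by (metis Zaction_def add_0)
  then have "N ** A 0 = (N ** A 0) ** A 0"
    by (metis matrix_mul_assoc)
  with N show ?thesis by simp
qed

lemma matrix_action_Zaction: "Zaction A \<Longrightarrow> matrix_action A"
  by unfold_locales (auto simp: Zaction_def Zaction_zero)

lemma spectrally_unitary_group_range:
  fixes A :: "int^'p \<Rightarrow> int^3^3"
  assumes "spectrally_unitary A" "Fix A = {0}"
  shows "spectrally_unitary_group (range A)"
proof -
  interpret matrix_action A
    using assms(1) by (simp add: spectrally_unitary_def matrix_action_Zaction)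
  show ?thesis
  proof
    show "mat 1 \<in> range A"
      by (metis map_zero rangeI)
    show "h ** k \<in> range A" "h ** k = k ** h" if "h \<in> range A" "k \<in> range A" for h k
      using that range_mult_mem map_commute by auto
    show "\<exists>k\<in>range A. k ** h = mat 1" if "h \<in> range A" for h
      using that map_uminus by blast
    show "det (h - mat 1) = 0" if "h \<in> range A" for h
      using that assms(1) has_eigenvalue_one_det by (auto simp: spectrally_unitary_def)
    show "v = 0" if "\<And>h. h \<in> range A \<Longrightarrow> h *v v = v" for v
      using that assms(2) by (auto simp: Fix_def)
  qed
qed

theorem theorem2:
  fixes A :: "int^'p \<Rightarrow> int^3^3"
  assumes "CARD('p) \<ge> 2"
    and "spectrally_unitary A"
    and "Fix A = {0}"
  shows "(\<exists>w :: 'p \<Rightarrow> int^'p. \<exists>i1 i2. i1 \<noteq> i2 \<and> Zbasis w \<and>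
           (\<exists>H Hinv :: int^3^3. H ** Hinv = mat 1 \<and> Hinv ** H = mat 1 \<and>
             (\<exists>a b c d :: int. a * d + 2 * (b + c) = 0 \<and>
                H ** A (w i1) ** Hinv =
                  vector [vector [1, a, b], vector [0, -1, 0], vector [0, 0, -1]] \<and>
                H ** A (w i2) ** Hinv =
                  vector [vector [-1, 0, c], vector [0, -1, d], vector [0, 0, 1]]) \<and>
             (\<forall>cf :: int^'p. cf $ i1 = 0 \<and> cf $ i2 = 0 \<longrightarrow>
                H ** A (\<Sum>i\<in>UNIV. cf $ i *s w i) ** Hinv = mat 1)))
         \<and> image_group A \<cong> Klein_four"
proof -
  have action: "matrix_action A"
    using assms(2) by (simp add: spectrally_unitary_def matrix_action_Zaction)
  interpret spectrally_unitary_group "range A"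
    using assms(2,3) by (rule spectrally_unitary_group_range)
  obtain H Hinv :: "int^3^3" and a b c d where HH: "H ** Hinv = mat 1" "Hinv ** H = mat 1"
    and rel: "a * d + 2 * (b + c) = 0" and K: "(\<lambda>h. H ** h ** Hinv) ` range A = klein_matrices a b c d"
    by (rule conj_klein) (rule that)
  interpret klein_matrix_action A "Hinv ** klein_gen1 a b ** H" "Hinv ** klein_gen2 c d ** H"
    using action HH rel K by (rule klein_matrix_action_conj)
  obtain w i1 i2 where w: "i1 \<noteq> i2" "Zbasis w" "A (w i1) = Hinv ** klein_gen1 a b ** H"
    "A (w i2) = Hinv ** klein_gen2 c d ** H" "\<And>k. k \<noteq> i1 \<Longrightarrow> k \<noteq> i2 \<Longrightarrow> A (w k) = mat 1"
    by (rule adapted_basis) (rule that)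
  have gens: "H ** A (w i1) ** Hinv = klein_gen1 a b" "H ** A (w i2) ** Hinv = klein_gen2 c d"
    using w(3,4) by (simp_all add: conj_cancel[OF HH(1)])
  have trivial: "H ** A (lincomb w cf) ** Hinv = mat 1" if "cf $ i1 = 0 \<and> cf $ i2 = 0" for cf
  proof -
    have "A (lincomb w cf) = mat 1"
    proof (rule map_lincomb_eq_one)
      fix i
      assume "cf $ i \<noteq> 0"
      with that have "i \<noteq> i1" "i \<noteq> i2" by auto
      then show "A (w i) = mat 1" by (rule w(5))
    qed
    with HH(1) show ?thesis by simp
  qed
  have "image_group A \<cong> Klein_four"
    unfolding image_group_def
    using conj_iso[OF HH(2), of "range A", unfolded K] klein_matrices_iso by (rule iso_trans)
  then show ?thesis
    unfolding klein_gen1_def[unfolded mat3_def, symmetric] klein_gen2_def[unfolded mat3_def, symmetric]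
      lincomb_def[symmetric]
    using w(1,2) HH rel gens trivial by blast
qed

end
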